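(* Let $\alpha\in(1,2)$ and denote by $\operatorname{arccot}$ the branch of the arccotangent taking values in $(0,\pi)$. For $x\in\mathbb R$, $$(\log\phi_\alpha)^*(x):=\sup_{\theta\in\mathbb R}\{\theta x-\log\phi_\alpha(\theta)\}=\alpha x+\tfrac x\pi\operatorname{arccot}\bigl(-\tfrac x\pi\bigr)-\tfrac12\log\bigl(1+\tfrac{x^2}{\pi^2}\bigr)-\log\sin(\pi(2-\alpha)).$$ This function is strictly increasing, and its (unique) root is negative if $\alpha\ne3/2$ and $0$ if $\alpha=3/2$.
   Context: The function $\phi_\alpha:\mathbb R\to(0,\infty]$ is given by $\phi_\alpha(\theta)=\frac{\sin(\pi(2-\alpha))}{\sin(\pi(\theta-\alpha))}$ for $\theta\in(\alpha,\alpha+1)$ and $\phi_\alpha(\theta)=+\infty$ otherwise (with $\log\infty=\infty$). It is the Biggins transform $\phi_\alpha(\theta)=\mathbb E[\sum_{i\ge1}x_i^\theta]$, where $(x_i)_{i\ge 1}$ has the law obtained as follows: take a spectrally positive $\alpha$-stable Lévy process $\zeta$ started at $0$ with $\mathbb E[e^{-\lambda\zeta_t}]=e^{Ct\lambda^\alpha}$, $\lambda>0$, let $\tau$ be its hitting time of $-1$, and take the decreasingly ordered jump sizes of $\zeta$ before time $\tau$ under the probability measure with density $\tau^{-1}/\mathbb E[\tau^{-1}]$. *)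

theory Defs
  imports "HOL-Analysis.Analysis"
begin

text \<open>Totalised by \<open>-\<infinity>\<close> on \<open>[-\<infinity>, 0]\<close>; the definitions below only use it on \<open>(0, \<infinity>]\<close>
  (see \<open>phi_pos\<close>). For real \<open>r > 0\<close> it agrees with the library logarithm.\<close>
definition elog :: "ereal \<Rightarrow> ereal" where
  "elog y = (case y of ereal r \<Rightarrow> (if 0 < r then ereal (ln r) else -\<infinity>) | PInfty \<Rightarrow> \<infinity> | MInfty \<Rightarrow> -\<infinity>)"

definition phi :: "real \<Rightarrow> real \<Rightarrow> ereal" where
  "phi \<alpha> \<theta> =
     (if \<theta> \<in> {\<alpha><..<\<alpha> + 1} then ereal (sin (pi * (2 - \<alpha>)) / sin (pi * (\<theta> - \<alpha>))) else \<infinity>)"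

lemma phi_pos:
  assumes "1 < \<alpha>" "\<alpha> < 2"
  shows "0 < phi \<alpha> \<theta>"
proof (cases "\<theta> \<in> {\<alpha><..<\<alpha> + 1}")
  case True
  have "0 < sin (pi * (2 - \<alpha>))" and "0 < sin (pi * (\<theta> - \<alpha>))"
    using assms True by (auto intro!: sin_gt_zero)
  then show ?thesis
    using True by (simp add: phi_def)
qed (auto simp: phi_def)

text \<open>Legendre--Fenchel transform. For \<open>f \<theta> = \<infinity>\<close> the term under the supremum is \<open>-\<infinity>\<close>.\<close>
definition conjugate :: "(real \<Rightarrow> ereal) \<Rightarrow> real \<Rightarrow> ereal" where
  "conjugate f x = (SUP \<theta>. ereal (\<theta> * x) - f \<theta>)"

definition arccot :: "real \<Rightarrow> real" where
  "arccot y = (THE t. 0 < t \<and> t < pi \<and> cot t = y)"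

text \<open>The description in \<open>arccot_def\<close> is proper.\<close>
lemma arccot_ex1: "\<exists>!t. 0 < t \<and> t < pi \<and> cot t = y"
proof (rule ex1I)
  have tan: "tan (pi/2 - t) = cot t" for t :: real
    by (simp add: tan_def cot_def sin_diff cos_diff)
  show "0 < pi/2 - arctan y \<and> pi/2 - arctan y < pi \<and> cot (pi/2 - arctan y) = y"
    using arctan_bounded[of y] tan[of "pi/2 - arctan y"] by (auto simp: tan_arctan)
  fix t assume t: "0 < t \<and> t < pi \<and> cot t = y"
  then have "arctan y = pi/2 - t"
    using tan[of t] by (intro arctan_unique) auto
  then show "t = pi/2 - arctan y" by simp
qed

end

theory Submission
  imports Defs
begin

text \<open>
  On its effective domain, \<open>log \<phi>\<^sub>\<alpha>\<close> is the convex function \<open>- ln cos\<close> up to an additive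
  constant and an affine change of variable: writing
  \<open>\<theta> = \<alpha> + 1/2 + u / \<pi>\<close> with \<open>\<bar>u\<bar> < \<pi>/2\<close> gives \<open>sin (\<pi> (\<theta> - \<alpha>)) = cos u\<close>. Since the derivative
  of \<open>- ln cos\<close> is \<open>tan\<close>, its conjugate must be the primitive
  \<open>y arctan y - ln (1 + y\<^sup>2) / 2\<close> of the inverse function \<open>arctan\<close>, and the optimal \<open>u\<close> is
  \<open>arctan y\<close> with \<open>y = x / \<pi>\<close>. Both halves of this claim come from the
  tangent lines of the primitive: the tangent at \<open>tan u\<close> is \<open>y \<mapsto> u y + ln (cos u)\<close>, so
  convexity is exactly the Fenchel--Young inequality (\<open>lncos_conj_ge\<close>), and the point of contact
  gives the case of equality (\<open>lncos_conj_eq\<close>).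

  The same tangent lines settle the rest. The conjugate \<open>F\<close> has at every \<open>x\<close> a supporting line
  whose slope is the maximiser \<open>\<theta> > \<alpha> > 0\<close> (\<open>stable_conj_supporting_line\<close>). Positive slopes
  make \<open>F\<close> strictly increasing, and slopes bounded below by \<open>\<alpha>\<close> bring it down to \<open>0\<close> at some
  \<open>x \<le> 0\<close>. Finally \<open>F 0 = - ln (sin (\<pi> (2 - \<alpha>)))\<close> is nonnegative and vanishes only
  for \<open>\<alpha> = 3/2\<close>, which decides the sign of the root.
\<close>

text \<open>The conjugate of \<open>- ln cos\<close> on \<open>(-\<pi>/2, \<pi>/2)\<close>.\<close>
definition lncos_conj :: "real \<Rightarrow> real" where
  "lncos_conj y = y * arctan y - ln (1 + y\<^sup>2) / 2"

lemma DERIV_lncos_conj: "(lncos_conj has_real_derivative arctan y) (at y)"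
proof -
  have "1 + y\<^sup>2 > 0"
    by (simp add: add_pos_nonneg)
  then have "((\<lambda>y. ln (1 + y\<^sup>2)) has_real_derivative 2 * y / (1 + y\<^sup>2)) (at y)"
    by (auto intro!: derivative_eq_intros)
  from DERIV_diff[OF DERIV_mult[OF DERIV_ident DERIV_arctan] DERIV_cdivide[OF this, of 2]]
  have "(lncos_conj has_real_derivative
      1 * arctan y + inverse (1 + y\<^sup>2) * y - 2 * y / (1 + y\<^sup>2) / 2) (at y)"
    unfolding lncos_conj_def[abs_def] .
  moreover have "1 * arctan y + inverse c * y - 2 * y / c / 2 = arctan y" for c
    by (cases "c = 0") (simp_all add: field_simps)
  ultimately show ?thesis
    by (simp only:)
qed

text \<open>Convexity holds because the derivative \<open>arctan\<close> is increasing.\<close>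
lemma lncos_conj_above_tangent:
  "lncos_conj y \<ge> lncos_conj z + arctan z * (y - z)"
proof -
  have "convex_on UNIV lncos_conj"
    by (rule convex_on_realI[where f' = arctan])
      (auto intro: DERIV_lncos_conj simp: arctan_le_iff)
  then have "lncos_conj y - lncos_conj z \<ge> arctan z * (y - z)"
    by (rule convex_on_imp_above_tangent) (auto intro: DERIV_lncos_conj)
  then show ?thesis
    by simp
qed

lemma ln_cos_arctan: "ln (cos (arctan y)) = - ln (1 + y\<^sup>2) / 2"
proof -
  have "1 + y\<^sup>2 > 0"
    by (simp add: add_pos_nonneg)
  then show ?thesis
    by (simp add: cos_arctan ln_div ln_sqrt)
qed

lemma lncos_conj_eq: "lncos_conj y = arctan y * y + ln (cos (arctan y))"
  by (simp add: lncos_conj_def ln_cos_arctan)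

text \<open>The Fenchel--Young inequality: the left-hand side, as a function of \<open>y\<close>, is the tangent
  line of \<open>lncos_conj\<close> at \<open>tan u\<close>.\<close>
lemma lncos_conj_ge:
  assumes "\<bar>u\<bar> < pi / 2"
  shows "u * y + ln (cos u) \<le> lncos_conj y"
proof -
  have "arctan (tan u) = u"
    using assms by (intro arctan_tan) auto
  then show ?thesis
    using lncos_conj_above_tangent[of "tan u" y] lncos_conj_eq[of "tan u"]
    by (simp add: algebra_simps)
qed

text \<open>The closed form of the conjugate, arranged so that the shift by \<open>\<alpha> + 1/2\<close> and the
  scaling by \<open>\<pi>\<close> are visible.\<close>
definition stable_conj :: "real \<Rightarrow> real \<Rightarrow> real" where
  "stable_conj a x = (a + 1/2) * x + lncos_conj (x / pi) - ln (sin (pi * (2 - a)))"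

lemma arccot_uminus: "arccot (- y) = pi / 2 + arctan y"
proof -
  have cot: "cot (pi / 2 + arctan y) = - y"
    using tan_arctan[of y] by (simp add: cot_def tan_def sin_add cos_add)
  show ?thesis
    unfolding arccot_def
    by (rule the1_equality[OF arccot_ex1]) (use arctan_bounded[of y] cot in auto)
qed

lemma stable_conj_arccot:
  "stable_conj a x = a * x + x / pi * arccot (- x / pi) - 1 / 2 * ln (1 + x\<^sup>2 / pi\<^sup>2)
     - ln (sin (pi * (2 - a)))"
  using arccot_uminus[of "x / pi"]
  by (simp add: stable_conj_def lncos_conj_def power_divide field_simps)

text \<open>The objective of the supremum in the centred variable \<open>u\<close>: the part depending on \<open>u\<close> is the
  objective for the conjugate of \<open>- ln cos\<close> at \<open>x / \<pi>\<close>.\<close>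
lemma minus_elog_phi:
  assumes "1 < a" "a < 2" "\<bar>u\<bar> < pi / 2" "t = a + 1/2 + u / pi"
  shows "ereal (t * x) - elog (phi a t) =
    ereal ((a + 1/2) * x + (u * (x / pi) + ln (cos u)) - ln (sin (pi * (2 - a))))"
proof -
  have t: "t \<in> {a<..<a + 1}"
    using assms(3) pi_gt_zero by (auto simp: assms(4) field_simps)
  have "pi * (t - a) = u + pi / 2"
    by (simp add: assms(4) field_simps)
  then have sin: "sin (pi * (t - a)) = cos u"
    by (simp add: sin_add)
  have pos: "cos u > 0" "sin (pi * (2 - a)) > 0"
    using assms by (auto intro!: cos_gt_zero_pi sin_gt_zero)
  then have "elog (phi a t) = ereal (ln (sin (pi * (2 - a))) - ln (cos u))"
    using t by (simp add: elog_def phi_def sin ln_div)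
  then show ?thesis
    by (simp add: assms(4) algebra_simps)
qed

text \<open>The upper bound is the Fenchel--Young inequality at \<open>y = x / \<pi>\<close>; it is attained at
  \<open>t = a + 1/2 + arctan (x / \<pi>) / \<pi>\<close>. Outside \<open>(a, a + 1)\<close> the objective is \<open>-\<infinity>\<close>.\<close>
lemma conjugate_elog_phi:
  assumes "1 < a" "a < 2"
  shows "conjugate (\<lambda>t. elog (phi a t)) x = ereal (stable_conj a x)"
  unfolding conjugate_def
proof (rule SUP_eqI)
  fix t :: real
  show "ereal (t * x) - elog (phi a t) \<le> ereal (stable_conj a x)"
  proof (cases "t \<in> {a<..<a + 1}")
    case True
    define u where "u = pi * (t - a - 1/2)"
    have "\<bar>t - a - 1/2\<bar> < 1/2"
      using True unfolding abs_less_iff by simp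
    then have "pi * \<bar>t - a - 1/2\<bar> < pi * (1/2)"
      by (intro mult_strict_left_mono) simp_all
    then have u: "\<bar>u\<bar> < pi / 2" "t = a + 1/2 + u / pi"
      by (auto simp: u_def abs_mult)
    show ?thesis
      using lncos_conj_ge[OF u(1), of "x / pi"]
      unfolding minus_elog_phi[OF assms u] by (simp add: stable_conj_def)
  qed (auto simp: phi_def elog_def)
next
  fix y :: ereal
  assume y: "\<And>t. t \<in> UNIV \<Longrightarrow> ereal (t * x) - elog (phi a t) \<le> y"
  have "\<bar>arctan (x / pi)\<bar> < pi / 2"
    using arctan_bounded[of "x / pi"] by auto
  from minus_elog_phi[OF assms this refl, of x] y[of "a + 1/2 + arctan (x / pi) / pi"]
  show "ereal (stable_conj a x) \<le> y"
    by (simp add: stable_conj_def lncos_conj_eq)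
qed

text \<open>The slope is the maximiser \<open>a + 1/2 + arctan (x / \<pi>) / \<pi>\<close>, which exceeds \<open>a\<close> because
  \<open>arctan\<close> stays above \<open>- \<pi>/2\<close>.\<close>
lemma stable_conj_supporting_line:
  obtains t where "a < t" "\<And>y. stable_conj a x + t * (y - x) \<le> stable_conj a y"
proof
  define v where "v = arctan (x / pi)"
  show "a < a + 1/2 + v / pi"
    using arctan_bounded[of "x / pi"] by (auto simp: v_def field_simps)
  fix y
  show "stable_conj a x + (a + 1/2 + v / pi) * (y - x) \<le> stable_conj a y"
    using lncos_conj_above_tangent[of "x / pi" "y / pi"]
    by (simp add: stable_conj_def v_def algebra_simps diff_divide_distrib)
qed

lemma strict_mono_stable_conj:
  assumes "a > 0"
  shows "strict_mono (stable_conj a)"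
proof (rule strict_monoI)
  fix x y :: real
  assume "x < y"
  obtain t where t: "a < t" "stable_conj a x + t * (y - x) \<le> stable_conj a y"
    using stable_conj_supporting_line by metis
  have "t * (y - x) > 0"
    using assms t(1) \<open>x < y\<close> by simp
  with t(2) show "stable_conj a x < stable_conj a y"
    by simp
qed

lemma stable_conj_root:
  assumes "a > 0" "stable_conj a 0 \<ge> 0"
  obtains x where "stable_conj a x = 0"
proof -
  \<comment> \<open>Following slope \<open>a\<close> down from the value at \<open>0\<close>, the axis is reached at \<open>x\<^sub>0\<close>; the function
    itself decreases to the left at least as fast.\<close>
  define x0 where "x0 = - stable_conj a 0 / a"
  have x0: "x0 \<le> 0"
    using assms by (simp add: x0_def)
  obtain t where t: "a < t" "stable_conj a x0 + t * (0 - x0) \<le> stable_conj a 0"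
    using stable_conj_supporting_line by metis
  have "a * (- x0) \<le> t * (- x0)"
    using t(1) x0 by (intro mult_right_mono) auto
  moreover have "a * (- x0) = stable_conj a 0"
    using assms by (simp add: x0_def)
  ultimately have "stable_conj a x0 \<le> 0"
    using t(2) by simp
  moreover have "continuous_on {x0..0} (stable_conj a)"
    unfolding stable_conj_def lncos_conj_def
    by (intro continuous_intros) (auto simp: add_nonneg_eq_0_iff)
  ultimately show ?thesis
    using IVT'[of "stable_conj a" x0 0 0] assms(2) x0 that by metis
qed

lemma stable_conj_0: "stable_conj a 0 = - ln (sin (pi * (2 - a)))"
  by (simp add: stable_conj_def lncos_conj_def)

lemma stable_conj_0_nonneg:
  assumes "1 < a" "a < 2"
  shows "stable_conj a 0 \<ge> 0"
proof -
  have "sin (pi * (2 - a)) > 0"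
    using assms by (auto intro!: sin_gt_zero)
  then show ?thesis
    by (simp add: stable_conj_0)
qed

text \<open>The value at \<open>0\<close> vanishes iff \<open>sin (\<pi> (2 - a)) = 1\<close>. Rewriting this sine as a cosine centred
  at \<open>a = 3/2\<close> reduces uniqueness to the injectivity of \<open>cos\<close> on \<open>[0, \<pi>]\<close>.\<close>
lemma stable_conj_0_eq_0_iff:
  assumes "1 < a" "a < 2"
  shows "stable_conj a 0 = 0 \<longleftrightarrow> a = 3/2"
proof -
  have "sin (pi * (2 - a)) > 0"
    using assms by (auto intro!: sin_gt_zero)
  moreover have "sin (pi * (2 - a)) = cos (pi * (3/2 - a))"
    using sin_add[of "pi * (3/2 - a)" "pi / 2"] by (simp add: algebra_simps)
  ultimately have "stable_conj a 0 = 0 \<longleftrightarrow> cos (pi * (3/2 - a)) = cos 0"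
    by (simp add: stable_conj_0)
  also have "\<dots> \<longleftrightarrow> a = 3/2"
  proof
    assume eq: "cos (pi * (3/2 - a)) = cos 0"
    have "\<bar>pi * (3/2 - a)\<bar> \<le> pi * 1"
      unfolding abs_mult using assms by (intro mult_mono) auto
    with eq have "\<bar>pi * (3/2 - a)\<bar> = 0"
      using cos_inj_pi[of "\<bar>pi * (3/2 - a)\<bar>" 0] by simp
    then show "a = 3/2"
      by simp
  next
    assume "a = 3/2"
    then show "cos (pi * (3/2 - a)) = cos 0"
      by (simp only: diff_self mult_zero_right)
  qed
  finally show ?thesis .
qed

theorem proposition8:
  fixes \<alpha> :: real
  assumes "1 < \<alpha>" and "\<alpha> < 2"
  shows "(\<forall>x. conjugate (\<lambda>\<theta>. elog (phi \<alpha> \<theta>)) x =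
              ereal (\<alpha> * x + x / pi * arccot (- x / pi) - 1 / 2 * ln (1 + x\<^sup>2 / pi\<^sup>2)
                     - ln (sin (pi * (2 - \<alpha>)))))
       \<and> strict_mono (conjugate (\<lambda>\<theta>. elog (phi \<alpha> \<theta>)))
       \<and> (\<exists>!x. conjugate (\<lambda>\<theta>. elog (phi \<alpha> \<theta>)) x = 0)
       \<and> (\<forall>x. conjugate (\<lambda>\<theta>. elog (phi \<alpha> \<theta>)) x = 0 \<longrightarrow>
              (\<alpha> \<noteq> 3 / 2 \<longrightarrow> x < 0) \<and> (\<alpha> = 3 / 2 \<longrightarrow> x = 0))"
proof -
  have conj: "conjugate (\<lambda>\<theta>. elog (phi \<alpha> \<theta>)) = (\<lambda>x. ereal (stable_conj \<alpha> x))"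
    using conjugate_elog_phi[OF assms] by blast
  have mono: "strict_mono (stable_conj \<alpha>)"
    using assms by (intro strict_mono_stable_conj) simp
  obtain r where r: "stable_conj \<alpha> r = 0"
    using stable_conj_root[of \<alpha>] stable_conj_0_nonneg[OF assms] assms by auto
  have root_iff: "stable_conj \<alpha> x = 0 \<longleftrightarrow> x = r" for x
    using strict_mono_eq[OF mono, of x r] r by simp
  have "r < 0 \<longleftrightarrow> stable_conj \<alpha> 0 > 0"
    using strict_mono_less[OF mono, of r 0] r by simp
  then have sign: "\<alpha> \<noteq> 3/2 \<Longrightarrow> r < 0" "\<alpha> = 3/2 \<Longrightarrow> r = 0"
    using stable_conj_0_nonneg[OF assms] stable_conj_0_eq_0_iff[OF assms] root_iff[of 0] by auto
  have "strict_mono (\<lambda>x. ereal (stable_conj \<alpha> x))"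
    using mono by (simp add: strict_mono_def)
  then show ?thesis
    unfolding conj using root_iff sign by (auto simp: stable_conj_arccot zero_ereal_def)
qed

end
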